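(* Let $T=\mathbb{Z}$ or $T=\mathbb{R}$, let $(\Omega,\mathcal{F},P)$ be a probability space, let $X:T\times\Omega\to\mathbb{R}^n$ be a stochastic process, let $\phi$ be an STL formula, and let $R:\mathfrak{F}(\Omega,\mathbb{R})\to\mathbb{R}$ be a monotone risk measure. Let $t\in T$ be such that $-\mathrm{RD}^\phi(X,t)$ and $-\rho^\phi(X,t)$ are real-valued random variables. Then $$R(-\mathrm{RD}^{\phi}(X,t))\le R(-\rho^\phi(X,t)).$$
   Context: Stochastic process: a function $X:T\times\Omega\to\mathbb{R}^n$ such that $X(t,\cdot)$ is measurable for each $t\in T$. $\mathfrak{F}(A,B)$ denotes the set of measurable functions $A\to B$; a signal is an element $x\in\mathfrak{F}(T,\mathbb{R}^n)$, and realizations $X(\cdot,\omega)$ are understood to be signals. $\rho^\phi(X,t)$ denotes $\omega\mapsto\rho^\phi(X(\cdot,\omega),t)$, and similarly for $\mathrm{RD}^\phi$. Risk measure: a function $R$ from the set $\mathfrak{F}(\Omega,\mathbb{R})$ of real-valued random variables to $\mathbb{R}$. It is monotone if $Z(\omega)\le Z'(\omega)$ for all $\omega\in\Omega$ implies $R(Z)\le R(Z')$. STL syntax. $\mathbb{B}:=\{\top,\bot\}$ with $\top:=1$, $\bot:=-1$ (so $\neg\top=\bot$, $\neg\bot=\top$). A predicate is a function $\mu:\mathbb{R}^n\to\mathbb{B}$ with $O^\mu:=\mu^{-1}(\top)$ and $O^{\neg\mu}:=\mathbb{R}^n\setminus O^\mu$; both sets are assumed nonempty and Borel measurable. STL formulas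 are generated by $$\phi ::= \top \mid \mu \mid \neg\phi \mid \phi'\wedge\phi'' \mid \phi' U_I\phi'' \mid \phi'\underline{U}_I\phi''$$ with time intervals $I\subseteq\mathbb{R}_{\ge0}$. Notation: $t\oplus I=\{t+s: s\in I\}$, $t\ominus I=\{t-s:s\in I\}$. $d:\mathbb{R}^n\times\mathbb{R}^n\to[0,\infty]$ is a metric on $\mathbb{R}^n$ (e.g. Euclidean), $\bar d(\zeta,S):=\inf_{\zeta'\in S}d(\zeta,\zeta')$, and $\mathrm{cl}$ is closure. Suprema and infima of extended-real quantities are extended ($\sup\emptyset=-\infty$, $\inf\emptyset=\infty$); those of $\mathbb{B}$-valued quantities are taken in the ordered set $\mathbb{B}$. Semantics $\beta^\phi(x,t)\in\mathbb{B}$: $\beta^\top(x,t)=\top$; $\beta^\mu(x,t)=\top$ if $x(t)\in O^\mu$ and $\bot$ otherwise; $\beta^{\neg\phi}=\neg\beta^\phi$; $\beta^{\phi'\wedge\phi''}=\min(\beta^{\phi'},\beta^{\phi''})$; $\beta^{\phi'U_I\phi''}(x,t)=\sup_{t''\in(t\oplus I)\cap T}\min\big(\beta^{\phi''}(x,t''),\inf_{t'\in(t,t'')\cap T}\beta^{\phi'}(x,t')\big)$; $\beta^{\phi'\underline U_I\phi''}(x,t)=\sup_{t''\in(t\ominus I)\cap T}\min\big(\beta^{\phi''}(x,t''),\inf_{t'\in(t'',t)\cap T}\beta^{\phi'}(x,t')\big)$. Robust semantics $\rho^\phi(x,t)\in[-\infty,\infty]$: $\rho^\top(x,t)=\infty$;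 $\rho^\mu(x,t)=\bar d(x(t),\mathrm{cl}(O^{\neg\mu}))$ if $x(t)\in O^\mu$ and $\rho^\mu(x,t)=-\bar d(x(t),\mathrm{cl}(O^{\mu}))$ otherwise; $\rho^{\neg\phi}=-\rho^\phi$; $\rho^{\phi'\wedge\phi''}=\min(\rho^{\phi'},\rho^{\phi''})$; and the until operators are given by the same sup/min/inf formulas as for $\beta$, with $\rho$ in place of $\beta$. Robustness degree: $\kappa(x,x'):=\sup_{t\in T}d(x(t),x'(t))$; $\mathcal{L}^{\neg\phi}(t):=\{x\in\mathfrak{F}(T,\mathbb{R}^n):\beta^{\neg\phi}(x,t)=\top\}$; $\mathrm{RD}^\phi(x,t):=\inf_{x'\in\mathrm{cl}(\mathcal{L}^{\neg\phi}(t))}\kappa(x,x')\in[0,\infty]$, the closure being with respect to $\kappa$. *)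

theory Defs
  imports "HOL-Probability.Probability"
begin

text \<open>The time domain is a set \<open>T\<close> of reals. A signal is a total function \<open>real \<Rightarrow> 'a\<close> that is
  measurable on \<open>T\<close>; its values outside \<open>T\<close> are junk, and nothing below depends on them at times
  \<open>t \<in> T\<close>. For \<open>T = \<int>\<close> the trace of the Borel sigma-algebra is the full power set, so every function
  is then a signal.\<close>

definition signals :: "real set \<Rightarrow> (real \<Rightarrow> 'a::topological_space) set" where
  "signals T = {x. x \<in> borel_measurable (restrict_space borel T)}"

definition stochastic_process ::
    "'w measure \<Rightarrow> real set \<Rightarrow> (real \<Rightarrow> 'w \<Rightarrow> 'a::topological_space) \<Rightarrow> bool" where
  "stochastic_process M T X \<longleftrightarrow>
     (\<forall>t\<in>T. X t \<in> borel_measurable M) \<and> (\<forall>\<omega>\<in>space M. (\<lambda>t. X t \<omega>) \<in> signals T)"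

text \<open>A risk measure acts on total functions \<open>'w \<Rightarrow> real\<close>. As the comparison is over \<open>space M\<close> only,
  a monotone \<open>R\<close> depends only on the values of its argument on \<open>space M\<close>; so it is the same thing as a
  monotone functional on the random variables with domain \<open>space M\<close>.\<close>

definition monotone_risk_measure :: "'w measure \<Rightarrow> (('w \<Rightarrow> real) \<Rightarrow> real) \<Rightarrow> bool" where
  "monotone_risk_measure M R \<longleftrightarrow>
     (\<forall>Z\<in>borel_measurable M. \<forall>Z'\<in>borel_measurable M.
        (\<forall>\<omega>\<in>space M. Z \<omega> \<le> Z' \<omega>) \<longrightarrow> R Z \<le> R Z')"

definition real_valued_rv :: "'w measure \<Rightarrow> ('w \<Rightarrow> ereal) \<Rightarrow> bool" where
  "real_valued_rv M Y \<longleftrightarrow> Y \<in> borel_measurable M \<and> (\<forall>\<omega>\<in>space M. \<bar>Y \<omega>\<bar> \<noteq> \<infinity>)"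

text \<open>The ordered set of truth values is \<^typ>\<open>bool\<close>, a complete linear order with
  \<^prop>\<open>False < True\<close>; a predicate \<open>\<mu>\<close> has \<open>O\<^sup>\<mu> = {z. \<mu> z}\<close>.\<close>

datatype 'a stl =
    STop
  | SPred "'a \<Rightarrow> bool"
  | SNeg "'a stl"
  | SAnd "'a stl" "'a stl"
  | SUntil "real set" "'a stl" "'a stl"
  | SSince "real set" "'a stl" "'a stl"

definition wf_predicate :: "('a::topological_space \<Rightarrow> bool) \<Rightarrow> bool" where
  "wf_predicate \<mu> \<longleftrightarrow> {z. \<mu> z} \<noteq> {} \<and> {z. \<not> \<mu> z} \<noteq> {} \<and>
     {z. \<mu> z} \<in> sets borel \<and> {z. \<not> \<mu> z} \<in> sets borel"

definition time_interval :: "real set \<Rightarrow> bool" where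
  "time_interval I \<longleftrightarrow> is_interval I \<and> I \<subseteq> {0..}"

primrec wf_stl :: "'a::topological_space stl \<Rightarrow> bool" where
  "wf_stl STop \<longleftrightarrow> True"
| "wf_stl (SPred \<mu>) \<longleftrightarrow> wf_predicate \<mu>"
| "wf_stl (SNeg \<phi>) \<longleftrightarrow> wf_stl \<phi>"
| "wf_stl (SAnd \<phi>1 \<phi>2) \<longleftrightarrow> wf_stl \<phi>1 \<and> wf_stl \<phi>2"
| "wf_stl (SUntil I \<phi>1 \<phi>2) \<longleftrightarrow> time_interval I \<and> wf_stl \<phi>1 \<and> wf_stl \<phi>2"
| "wf_stl (SSince I \<phi>1 \<phi>2) \<longleftrightarrow> time_interval I \<and> wf_stl \<phi>1 \<and> wf_stl \<phi>2"

primrec beta :: "real set \<Rightarrow> 'a stl \<Rightarrow> (real \<Rightarrow> 'a) \<Rightarrow> real \<Rightarrow> bool" where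
  "beta T STop x t = True"
| "beta T (SPred \<mu>) x t = \<mu> (x t)"
| "beta T (SNeg \<phi>) x t = (\<not> beta T \<phi> x t)"
| "beta T (SAnd \<phi>1 \<phi>2) x t = min (beta T \<phi>1 x t) (beta T \<phi>2 x t)"
| "beta T (SUntil I \<phi>1 \<phi>2) x t =
     (SUP t2\<in>((\<lambda>s. t + s) ` I) \<inter> T.
        min (beta T \<phi>2 x t2) (INF t1\<in>{t<..<t2} \<inter> T. beta T \<phi>1 x t1))"
| "beta T (SSince I \<phi>1 \<phi>2) x t =
     (SUP t2\<in>((\<lambda>s. t - s) ` I) \<inter> T.
        min (beta T \<phi>2 x t2) (INF t1\<in>{t2<..<t} \<inter> T. beta T \<phi>1 x t1))"

definition extended_metric :: "('a \<Rightarrow> 'a \<Rightarrow> ereal) \<Rightarrow> bool" where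
  "extended_metric d \<longleftrightarrow>
     (\<forall>x y. 0 \<le> d x y) \<and> (\<forall>x y. d x y = 0 \<longleftrightarrow> x = y) \<and>
     (\<forall>x y. d x y = d y x) \<and> (\<forall>x y z. d x z \<le> d x y + d y z)"

definition dist_set :: "('a \<Rightarrow> 'a \<Rightarrow> ereal) \<Rightarrow> 'a \<Rightarrow> 'a set \<Rightarrow> ereal" where
  "dist_set d z S = (INF z'\<in>S. d z z')"

text \<open>Here \<^const>\<open>closure\<close> is the closure in the topology of the state space, which need not
  be induced by \<open>d\<close>.\<close>

primrec rho :: "('a::topological_space \<Rightarrow> 'a \<Rightarrow> ereal) \<Rightarrow> real set \<Rightarrow> 'a stl
    \<Rightarrow> (real \<Rightarrow> 'a) \<Rightarrow> real \<Rightarrow> ereal" where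
  "rho d T STop x t = \<infinity>"
| "rho d T (SPred \<mu>) x t =
     (if \<mu> (x t) then dist_set d (x t) (closure {z. \<not> \<mu> z})
      else - dist_set d (x t) (closure {z. \<mu> z}))"
| "rho d T (SNeg \<phi>) x t = - rho d T \<phi> x t"
| "rho d T (SAnd \<phi>1 \<phi>2) x t = min (rho d T \<phi>1 x t) (rho d T \<phi>2 x t)"
| "rho d T (SUntil I \<phi>1 \<phi>2) x t =
     (SUP t2\<in>((\<lambda>s. t + s) ` I) \<inter> T.
        min (rho d T \<phi>2 x t2) (INF t1\<in>{t<..<t2} \<inter> T. rho d T \<phi>1 x t1))"
| "rho d T (SSince I \<phi>1 \<phi>2) x t =
     (SUP t2\<in>((\<lambda>s. t - s) ` I) \<inter> T.
        min (rho d T \<phi>2 x t2) (INF t1\<in>{t2<..<t} \<inter> T. rho d T \<phi>1 x t1))"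

definition kappa :: "('a \<Rightarrow> 'a \<Rightarrow> ereal) \<Rightarrow> real set \<Rightarrow> (real \<Rightarrow> 'a) \<Rightarrow> (real \<Rightarrow> 'a) \<Rightarrow> ereal" where
  "kappa d T x x' = (SUP t\<in>T. d (x t) (x' t))"

definition kappa_closure :: "('a::topological_space \<Rightarrow> 'a \<Rightarrow> ereal) \<Rightarrow> real set
    \<Rightarrow> (real \<Rightarrow> 'a) set \<Rightarrow> (real \<Rightarrow> 'a) set" where
  "kappa_closure d T L = {x \<in> signals T. \<forall>\<epsilon>::real. \<epsilon> > 0 \<longrightarrow> (\<exists>x'\<in>L. kappa d T x x' < ereal \<epsilon>)}"

definition sat_set :: "real set \<Rightarrow> 'a::topological_space stl \<Rightarrow> real \<Rightarrow> (real \<Rightarrow> 'a) set" where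
  "sat_set T \<phi> t = {x \<in> signals T. beta T \<phi> x t}"

definition RD :: "('a::topological_space \<Rightarrow> 'a \<Rightarrow> ereal) \<Rightarrow> real set \<Rightarrow> 'a stl
    \<Rightarrow> (real \<Rightarrow> 'a) \<Rightarrow> real \<Rightarrow> ereal" where
  "RD d T \<phi> x t = (INF x'\<in>kappa_closure d T (sat_set T (SNeg \<phi>) t). kappa d T x x')"

end

theory Submission imports Defs begin

(* The robustness bounds how far a signal can be moved, in the sup-distance, without changing the
   truth value of the formula: if x' violates \<phi>, then \<rho>(x) \<le> \<kappa>(x, x'), and if x' satisfies \<phi>,
   then -\<kappa>(x, x') \<le> \<rho>(x). Proving both bounds simultaneously lets an induction on \<phi> pass through
   negation. By the triangle inequality the first one extends to the closure of the violating
   signals, so \<rho> \<le> RD pointwise, and monotonicity of R concludes. *)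

text \<open>Finiteness matters because \<open>real_of_ereal\<close> sends both infinities to 0 and
  so is not monotone on all of \<open>ereal\<close>.\<close>

lemma real_of_ereal_mono_finite:
  fixes a b :: ereal
  assumes "a \<le> b" "\<bar>a\<bar> \<noteq> \<infinity>" "\<bar>b\<bar> \<noteq> \<infinity>"
  shows "real_of_ereal a \<le> real_of_ereal b"
  using assms by (cases a; cases b) auto

text \<open>Passing to the closure enlarges the set and can only lower the infimum. Nothing else
  about the closure enters, so its topology may be unrelated to \<open>d\<close>.\<close>

lemma dist_set_closure_le:
  assumes "z' \<in> S"
  shows "dist_set d z (closure S) \<le> d z z'"
  using assms closure_subset unfolding dist_set_def by (blast intro: INF_lower)

lemma dist_set_nonneg:
  assumes "extended_metric d"
  shows "0 \<le> dist_set d z S"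
  using assms by (auto simp: dist_set_def extended_metric_def intro: INF_greatest)

lemma le_kappa: "t \<in> T \<Longrightarrow> d (x t) (x' t) \<le> kappa d T x x'"
  unfolding kappa_def by (rule SUP_upper)

lemma kappa_triangle:
  assumes "extended_metric d"
  shows "kappa d T x z \<le> kappa d T x y + kappa d T y z"
  unfolding kappa_def[of d T x z]
proof (rule SUP_least)
  fix t assume "t \<in> T"
  have "d (x t) (z t) \<le> d (x t) (y t) + d (y t) (z t)"
    using assms by (simp add: extended_metric_def)
  also have "\<dots> \<le> kappa d T x y + kappa d T y z"
    using \<open>t \<in> T\<close> by (intro add_mono le_kappa)
  finally show "d (x t) (z t) \<le> kappa d T x y + kappa d T y z" .
qed

lemma SUP_min_INF_bool_iff:
  "(SUP a\<in>A. min (P a) (INF b\<in>B a. Q b)) \<longleftrightarrow> (\<exists>a\<in>A. P a \<and> (\<forall>b\<in>B a. Q b))"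
  by (auto simp: min_def)

text \<open>The common induction step for until and since: \<open>P\<close>, \<open>Q\<close> are
  truth values along one signal, \<open>p\<close>, \<open>q\<close> robustness values along another.
  A witness for truth bounds the supremum below by \<open>l\<close>. Without a witness, every
  candidate \<open>a\<close> has a failing component, which caps its minimum by
  \<open>u\<close>.\<close>

lemma SUP_min_INF_bounds:
  fixes p q :: "'b \<Rightarrow> 'c::{complete_linorder}"
  assumes P: "\<And>a. a \<in> A \<Longrightarrow> (P a \<longrightarrow> l \<le> p a) \<and> (\<not> P a \<longrightarrow> p a \<le> u)"
    and Q: "\<And>a b. a \<in> A \<Longrightarrow> b \<in> B a \<Longrightarrow> (Q b \<longrightarrow> l \<le> q b) \<and> (\<not> Q b \<longrightarrow> q b \<le> u)"
  defines "s \<equiv> SUP a\<in>A. min (p a) (INF b\<in>B a. q b)"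
  shows "((SUP a\<in>A. min (P a) (INF b\<in>B a. Q b)) \<longrightarrow> l \<le> s) \<and>
         (\<not> (SUP a\<in>A. min (P a) (INF b\<in>B a. Q b)) \<longrightarrow> s \<le> u)"
  unfolding SUP_min_INF_bool_iff
proof (intro conjI impI)
  assume "\<exists>a\<in>A. P a \<and> (\<forall>b\<in>B a. Q b)"
  then obtain a where a: "a \<in> A" "P a" "\<And>b. b \<in> B a \<Longrightarrow> Q b"
    by blast
  then have "l \<le> min (p a) (INF b\<in>B a. q b)"
    using P Q by (auto intro!: INF_greatest)
  then show "l \<le> s"
    unfolding s_def using a(1) by (rule SUP_upper2[rotated])
next
  assume *: "\<not> (\<exists>a\<in>A. P a \<and> (\<forall>b\<in>B a. Q b))"
  show "s \<le> u"
    unfolding s_def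
  proof (rule SUP_least)
    fix a assume a: "a \<in> A"
    show "min (p a) (INF b\<in>B a. q b) \<le> u"
    proof (cases "P a")
      case True
      with * a obtain b where b: "b \<in> B a" "\<not> Q b"
        by blast
      then have "(INF b\<in>B a. q b) \<le> u"
        using Q[OF a b(1)] by (auto intro: INF_lower2)
      then show ?thesis
        by (rule min.coboundedI2)
    next
      case False
      then show ?thesis
        using P[OF a] by (auto intro: min.coboundedI1)
    qed
  qed
qed

lemma rho_kappa_bounds:
  assumes d: "extended_metric d" and "t \<in> T"
  shows "(beta T \<phi> x' t \<longrightarrow> - kappa d T x x' \<le> rho d T \<phi> x t) \<and>
         (\<not> beta T \<phi> x' t \<longrightarrow> rho d T \<phi> x t \<le> kappa d T x x')"
  using \<open>t \<in> T\<close>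
\<comment> \<open>Temporal operators evaluate subformulas at other times of \<open>T\<close>, so
  \<open>t\<close> varies; the bound \<open>kappa d T x x'\<close> is the same for all of
  them.\<close>
proof (induction \<phi> arbitrary: t)
  case STop
  show ?case by simp
next
  case (SPred \<mu>)
  have le: "d (x t) (x' t) \<le> kappa d T x x'"
    using SPred by (rule le_kappa)
  moreover have "0 \<le> d (x t) (x' t)"
    using d by (simp add: extended_metric_def)
  ultimately have nonneg: "0 \<le> kappa d T x x'"
    by (rule order_trans[rotated])
  have near: "dist_set d (x t) (closure S) \<le> kappa d T x x'" if "x' t \<in> S" for S
    using dist_set_closure_le[OF that] le by (rule order_trans)
  \<comment> \<open>If \<open>x t\<close> and \<open>x' t\<close> lie on opposite sides of
    \<open>\<mu>\<close>, then \<open>x' t\<close> belongs to the set to which the distance is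
    measured, and \<open>near\<close> applies. On the same side, the sign of the robustness already
    suffices.\<close>
  show ?case
    using near[of "{z. \<mu> z}"] near[of "{z. \<not> \<mu> z}"] nonneg
      dist_set_nonneg[OF d, of "x t" "closure {z. \<mu> z}"]
      dist_set_nonneg[OF d, of "x t" "closure {z. \<not> \<mu> z}"]
    by (auto intro: order_trans[of _ 0])
next
  case (SNeg \<phi>)
  then show ?case
    using ereal_uminus_le_reorder by auto
next
  case (SAnd \<phi>1 \<phi>2)
  have "beta T (SAnd \<phi>1 \<phi>2) x' t \<longleftrightarrow> beta T \<phi>1 x' t \<and> beta T \<phi>2 x' t"
    by (auto simp: min_def)
  then show ?case
    using SAnd by (auto simp: min_le_iff_disj simp del: beta.simps)
next
  case (SUntil I \<phi>1 \<phi>2)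
  show ?case
    unfolding beta.simps rho.simps
    by (rule SUP_min_INF_bounds) (use SUntil.IH in blast)+
next
  case (SSince I \<phi>1 \<phi>2)
  show ?case
    unfolding beta.simps rho.simps
    by (rule SUP_min_INF_bounds) (use SSince.IH in blast)+
qed

lemma rho_le_RD:
  assumes "extended_metric d" "t \<in> T"
  shows "rho d T \<phi> x t \<le> RD d T \<phi> x t"
  unfolding RD_def
proof (rule INF_greatest)
  fix x' assume x': "x' \<in> kappa_closure d T (sat_set T (SNeg \<phi>) t)"
  show "rho d T \<phi> x t \<le> kappa d T x x'"
  \<comment> \<open>A limit point \<open>x'\<close> need not violate \<open>\<phi>\<close> itself,
    so the bound is applied to a violating signal \<open>y\<close> within \<open>\<epsilon>\<close>
    of it.\<close>
  proof (rule ereal_le_epsilon2)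
    fix \<epsilon> :: real assume "0 < \<epsilon>"
    with x' obtain y where "\<not> beta T \<phi> y t" and y: "kappa d T x' y < ereal \<epsilon>"
      by (auto simp: kappa_closure_def sat_set_def)
    then have "rho d T \<phi> x t \<le> kappa d T x y"
      using rho_kappa_bounds[OF assms] by blast
    also have "\<dots> \<le> kappa d T x x' + kappa d T x' y"
      using assms(1) by (rule kappa_triangle)
    also have "\<dots> \<le> kappa d T x x' + ereal \<epsilon>"
      using y by (intro add_left_mono) simp
    finally show "rho d T \<phi> x t \<le> kappa d T x x' + ereal \<epsilon>" .
  qed
qed

theorem theorem3:
  fixes M :: "'w measure"
    and T :: "real set"
    and X :: "real \<Rightarrow> 'w \<Rightarrow> real ^ 'n"
    and d :: "real ^ 'n \<Rightarrow> real ^ 'n \<Rightarrow> ereal"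
    and \<phi> :: "(real ^ 'n) stl"
    and R :: "('w \<Rightarrow> real) \<Rightarrow> real"
    and t :: real
  assumes "T = \<int> \<or> T = UNIV"
    and "prob_space M"
    and "stochastic_process M T X"
    and "extended_metric d"
    and "wf_stl \<phi>"
    and "monotone_risk_measure M R"
    and "t \<in> T"
    and "real_valued_rv M (\<lambda>\<omega>. - RD d T \<phi> (\<lambda>s. X s \<omega>) t)"
    and "real_valued_rv M (\<lambda>\<omega>. - rho d T \<phi> (\<lambda>s. X s \<omega>) t)"
  shows "R (\<lambda>\<omega>. real_of_ereal (- RD d T \<phi> (\<lambda>s. X s \<omega>) t))
           \<le> R (\<lambda>\<omega>. real_of_ereal (- rho d T \<phi> (\<lambda>s. X s \<omega>) t))"
proof -
  \<comment> \<open>Monotonicity of \<open>R\<close> reduces the claim to a pointwise inequality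
    between realizations; both real-valued versions inherit measurability from the extended
    ones.\<close>
  have "R (\<lambda>\<omega>. real_of_ereal (- RD d T \<phi> (\<lambda>s. X s \<omega>) t))
      \<le> R (\<lambda>\<omega>. real_of_ereal (- rho d T \<phi> (\<lambda>s. X s \<omega>) t))"
    if "\<forall>\<omega>\<in>space M. real_of_ereal (- RD d T \<phi> (\<lambda>s. X s \<omega>) t)
      \<le> real_of_ereal (- rho d T \<phi> (\<lambda>s. X s \<omega>) t)"
    using assms(6,8,9) that
    by (auto simp: monotone_risk_measure_def real_valued_rv_def
        intro!: borel_measurable_real_of_ereal)
  moreover have "real_of_ereal (- RD d T \<phi> (\<lambda>s. X s \<omega>) t)
      \<le> real_of_ereal (- rho d T \<phi> (\<lambda>s. X s \<omega>) t)" if "\<omega> \<in> space M" for \<omega>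
  proof (rule real_of_ereal_mono_finite)
    show "- RD d T \<phi> (\<lambda>s. X s \<omega>) t \<le> - rho d T \<phi> (\<lambda>s. X s \<omega>) t"
      using rho_le_RD[OF assms(4,7)] by simp
    show "\<bar>- RD d T \<phi> (\<lambda>s. X s \<omega>) t\<bar> \<noteq> \<infinity>" "\<bar>- rho d T \<phi> (\<lambda>s. X s \<omega>) t\<bar> \<noteq> \<infinity>"
      using assms(8,9) that by (auto simp: real_valued_rv_def)
  qed
  ultimately show ?thesis
    by blast
qed

end
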